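(* Fix $\alpha$ with $0 \leq \alpha < n$, and let $p(\cdot) \in \mathcal{P}(\mathbb{R}^n)$ satisfy $p_+ \leq \frac{n}{\alpha}$. Define $q(\cdot) \in \mathcal{P}(\mathbb{R}^n)$ by $\frac{1}{p(x)} - \frac{1}{q(x)} = \frac{\alpha}{n}$, $x\in\mathbb{R}^n$. If $M_\alpha : L^{p(\cdot)}(\mathbb{R}^n) \to L^{q(\cdot)}(\mathbb{R}^n)$, then $p_- > 1$.
   Context: Conventions: $1/\infty = 0$, and $n/\alpha=\infty$ when $\alpha=0$. $\mathcal{P}(\mathbb{R}^n)$ is the set of Lebesgue measurable functions $p(\cdot):\mathbb{R}^n\to[1,\infty]$ (exponent functions); $p_-=\operatorname{ess\,inf}_{x\in\mathbb{R}^n} p(x)$, $p_+=\operatorname{ess\,sup}_{x\in\mathbb{R}^n} p(x)$. Modular: with $\Omega_\infty=\{x\in\mathbb{R}^n: p(x)=\infty\}$, $\rho_{p(\cdot)}(f)=\int_{\mathbb{R}^n\setminus\Omega_\infty}|f(x)|^{p(x)}\,dx+\|f\|_{L^\infty(\Omega_\infty)}$. Norm: $\|f\|_{p(\cdot)}=\inf\{\lambda>0:\rho_{p(\cdot)}(f/\lambda)\le 1\}$. $L^{p(\cdot)}(\mathbb{R}^n)$ is the set of measurable $f$ with $\rho_{p(\cdot)}(f/\lambda)<\infty$ for some $\lambda>0$. Fractional maximal operator: $M_\alpha f(x)=\sup_{Q\ni x}|Q|^{\frac{\alpha}{n}}\frac{1}{|Q|}\int_Q|f(y)|\,dy$, where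 the supremum is over cubes $Q\subset\mathbb{R}^n$ containing $x$ with sides parallel to the coordinate axes ($M_0=M$ is the Hardy-Littlewood maximal operator). For an operator $T$, $T:L^{p(\cdot)}(\mathbb{R}^n)\to L^{q(\cdot)}(\mathbb{R}^n)$ means that there is a constant $C$ with $\|Tf\|_{q(\cdot)}\le C\|f\|_{p(\cdot)}$ for all $f\in L^{p(\cdot)}(\mathbb{R}^n)$. *)

theory Defs
  imports "HOL-Analysis.Analysis" "HOL-Probability.Essential_Supremum"
begin

text \<open>
  Exponents and functions take values in \<^typ>\<open>ereal\<close>: exponents may be infinite, and so may
  values of maximal functions. Moduli, modulars and norms are \<^typ>\<open>ennreal\<close>-valued.
  In \<^typ>\<open>ereal\<close>, \<open>1 / \<infinity> = 0\<close> and \<open>a / 0 = \<infinity>\<close> for \<open>a > 0\<close>, which are exactly the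
  conventions needed for exponents.
\<close>

definition exponents :: "(real ^ 'n \<Rightarrow> ereal) set" where
  "exponents = {p \<in> borel_measurable lebesgue. \<forall>x. 1 \<le> p x}"

definition essinf :: "'a measure \<Rightarrow> ('a \<Rightarrow> ereal) \<Rightarrow> ereal" where
  "essinf M f = Sup {z. AE x in M. z \<le> f x}"

definition p_minus :: "(real ^ 'n \<Rightarrow> ereal) \<Rightarrow> ereal" where
  "p_minus p = essinf lebesgue p"

definition p_plus :: "(real ^ 'n \<Rightarrow> ereal) \<Rightarrow> ereal" where
  "p_plus p = esssup lebesgue p"

definition modulus :: "('a \<Rightarrow> ereal) \<Rightarrow> 'a \<Rightarrow> ennreal" where
  "modulus f x = e2ennreal \<bar>f x\<bar>"

text \<open>Only used with exponents \<open>r \<ge> 1\<close>, so that \<open>\<infinity>\<close> to the power \<open>r\<close> is \<open>\<infinity>\<close>.\<close>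

definition ennreal_powr :: "ennreal \<Rightarrow> real \<Rightarrow> ennreal" where
  "ennreal_powr t r = (if t = \<infinity> then \<infinity> else ennreal (enn2real t powr r))"

definition Omega_inf :: "(real ^ 'n \<Rightarrow> ereal) \<Rightarrow> (real ^ 'n) set" where
  "Omega_inf p = {x. p x = \<infinity>}"

text \<open>
  The essential supremum is taken in \<^typ>\<open>ennreal\<close>, so it is \<open>0\<close> (and not \<open>-\<infinity>\<close>) when
  \<open>Omega_inf p\<close> is a null set.
\<close>

definition modular :: "(real ^ 'n \<Rightarrow> ereal) \<Rightarrow> (real ^ 'n \<Rightarrow> ereal) \<Rightarrow> ennreal" where
  "modular p f =
     (\<integral>\<^sup>+ x\<in>- Omega_inf p. ennreal_powr (modulus f x) (real_of_ereal (p x)) \<partial>lebesgue)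
     + esssup (restrict_space lebesgue (Omega_inf p)) (modulus f)"

definition Lnorm :: "(real ^ 'n \<Rightarrow> ereal) \<Rightarrow> (real ^ 'n \<Rightarrow> ereal) \<Rightarrow> ennreal" where
  "Lnorm p f = Inf {ennreal l |l. 0 < l \<and> modular p (\<lambda>x. f x / ereal l) \<le> 1}"

definition Lspace :: "(real ^ 'n \<Rightarrow> ereal) \<Rightarrow> (real ^ 'n \<Rightarrow> ereal) set" where
  "Lspace p = {f \<in> borel_measurable lebesgue.
     \<exists>l::real. 0 < l \<and> modular p (\<lambda>x. f x / ereal l) < \<infinity>}"

definition cubes :: "(real ^ 'n) set set" where
  "cubes = {cbox a (a + (\<chi> i. l)) |a l. 0 < l}"

definition frac_maximal :: "real \<Rightarrow> (real ^ 'n \<Rightarrow> ereal) \<Rightarrow> real ^ 'n \<Rightarrow> ereal" where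
  "frac_maximal \<alpha> f x =
     enn2ereal (SUP Q \<in> {Q \<in> cubes. x \<in> Q}.
       ennreal (measure lebesgue Q powr (\<alpha> / real CARD('n))) *
       (ennreal (1 / measure lebesgue Q) * (\<integral>\<^sup>+ y\<in>Q. modulus f y \<partial>lebesgue)))"

definition maps_into ::
  "((real ^ 'n \<Rightarrow> ereal) \<Rightarrow> real ^ 'n \<Rightarrow> ereal) \<Rightarrow>
   (real ^ 'n \<Rightarrow> ereal) \<Rightarrow> (real ^ 'n \<Rightarrow> ereal) \<Rightarrow> bool" where
  "maps_into T p q \<longleftrightarrow>
     (\<exists>C::real. 0 \<le> C \<and> (\<forall>f\<in>Lspace p. Lnorm q (T f) \<le> ennreal C * Lnorm p f))"

end

theory Submission
  imports Defs
begin

text \<open>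
  The proof shows that if \<open>p\<close> comes arbitrarily close to \<open>1\<close>, then \<open>M\<^sub>\<alpha>\<close> gains a factor that no
  norm inequality permits: the maximal function of an approximate point mass at \<open>a\<close> decays like
  \<open>\<bar>x - a\<bar>\<^bsup>\<alpha> - n\<^esup>\<close>, and with exponent \<open>q = n / (n - \<alpha>)\<close>, the partner of \<open>p = 1\<close>, every dyadic
  annulus around \<open>a\<close> contributes the same amount to the modular of this function. Many annuli
  between the point mass and a fixed scale then give a modular as large as desired.

  Suppose \<open>p\<^sub>- = 1\<close>. Let \<open>C\<close> bound the norm of \<open>M\<^sub>\<alpha>\<close>, let \<open>\<theta> = \<alpha> / n\<close>, and for a small \<open>\<epsilon>\<close> let \<open>E\<close> be the
  set of positive measure where \<open>p < 1 + \<epsilon>\<close>. A density point \<open>a\<close> of \<open>E\<close> is the corner of dyadic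
  cubes with volumes \<open>v\<^sub>j\<close> such that the parts \<open>S\<^sub>j\<close> of \<open>E\<close> between consecutive cubes have measure at
  least \<open>v\<^sub>j / 4\<close> (\<open>density_corner_cubes\<close>, \<open>dyadic_annuli\<close>). Let \<open>u\<^sub>j\<close> be the indicator of \<open>S\<^sub>j\<close>
  divided by \<open>v\<^sub>j\<close>, and let \<open>b\<^sub>j\<close> be its norm with exponent \<open>p\<close>. For \<open>i < J\<close> the maximal function of
  \<open>u\<^sub>J\<close> is at least \<open>v\<^sub>i\<^bsup>\<theta> - 1\<^esup> / 4\<close> on \<open>S\<^sub>i\<close>, which is a quarter of \<open>v\<^sub>i\<^sup>\<theta> u\<^sub>i\<close>.

  The difficulty is that \<open>p\<close> is only measurable, and that the scale from which on \<open>E\<close> is dense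
  depends on \<open>\<epsilon>\<close>, so the norms at different scales cannot be compared by continuity of \<open>p\<close>. Two
  facts replace this. First, on one annulus the change of exponent from \<open>p\<close> to \<open>q\<close> costs a constant
  factor, whatever \<open>p\<close> does there (\<open>nn_integral_powr_exchange\<close>): if \<open>u\<^sub>i / b\<close> has a modular greater
  than \<open>1\<close> with exponent \<open>p\<close>, then \<open>v\<^sub>i\<^sup>\<theta> u\<^sub>i / b\<close> has a modular bounded below with exponent \<open>q\<close>. Second,
  \<open>b\<^sub>j\<close> grows at most like \<open>2\<^bsup>n \<epsilon> j\<^esup>\<close> and is bounded below (\<open>critical_scale\<close>). If \<open>\<epsilon>\<close> is small
  relative to \<open>1 / N\<close>, a pigeonhole argument (\<open>slow_growth_pigeonhole\<close>) yields an index \<open>J\<close> for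
  which \<open>b\<^sub>J\<close> is not larger than any of the \<open>N\<close> preceding \<open>b\<^sub>i\<close>, up to the factor of two lost by
  restricting norms to powers of two. Then \<open>M\<^sub>\<alpha> u\<^sub>J / (C b\<^sub>J)\<close> has a modular
  with exponent \<open>q\<close> of at least a constant times \<open>N\<close>, where the constant depends on \<open>C\<close> and \<open>\<theta>\<close> only.
  For large \<open>N\<close> this contradicts the boundedness of \<open>M\<^sub>\<alpha>\<close>.
\<close>

section \<open>Density points and dyadic annuli\<close>

definition corner_cube :: "real ^ 'n \<Rightarrow> real \<Rightarrow> (real ^ 'n) set" where
  "corner_cube a l = cbox a (a + (\<chi> i. l))"

lemma corner_cube_eq: "corner_cube a l = cbox a (a + l *\<^sub>R One)" for a :: "real ^ 'n"
proof -
  have "One $ i = (1::real)" for i :: 'n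
  proof -
    have "(One :: real ^ 'n) \<bullet> axis i 1 = 1"
      using inner_sum_left_Basis[of "axis i 1 :: real ^ 'n" "\<lambda>_. 1"] by (simp add: axis_in_Basis_iff)
    then show ?thesis by (simp add: inner_axis)
  qed
  then have "l *\<^sub>R One = (\<chi> i. l :: real ^ 'n)" by (simp add: vec_eq_iff)
  then show ?thesis by (simp add: corner_cube_def)
qed

lemma corner_cube_in_cubes: "0 < l \<Longrightarrow> corner_cube a l \<in> cubes"
  by (auto simp: cubes_def corner_cube_def)

lemma corner_cube_lmeasurable: "corner_cube a l \<in> lmeasurable"
  by (simp add: corner_cube_def)

lemma measure_corner_cube:
  "0 \<le> l \<Longrightarrow> measure lebesgue (corner_cube a l) = l ^ CARD('n)" for a :: "real ^ 'n"
  by (simp add: corner_cube_eq measure_lborel_cbox_eq inner_add_left)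

lemma corner_cube_mono: "l \<le> l' \<Longrightarrow> corner_cube a l \<subseteq> corner_cube a l'"
  unfolding corner_cube_def subset_iff mem_box_cart
  by (auto intro: order_trans[OF _ add_left_mono])

text \<open>
  This is Lebesgue's density theorem for cubes that have the point as a corner: it is
  Lebesgue differentiation (\<open>integrable_ccontinuous_explicit\<close>) of the indicator of \<open>E\<close> at a
  point of \<open>E\<close> outside the exceptional null set.
\<close>
lemma density_corner_cubes:
  fixes E :: "(real ^ 'n) set"
  assumes E: "E \<in> sets lebesgue" and pos: "\<not> negligible E" and c: "c < 1"
  obtains x R where "0 < R" "R \<le> 1"
    "\<And>h. 0 < h \<Longrightarrow> h \<le> R \<Longrightarrow> c * h ^ CARD('n) \<le> measure lebesgue (E \<inter> corner_cube x h)"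
proof -
  define f :: "real ^ 'n \<Rightarrow> real" where "f = indicator E"
  have meas: "E \<inter> cbox a b \<in> lmeasurable" for a b
    using E by (simp add: fmeasurable_Int_fmeasurable Int_commute[of E])
  have int: "(f has_integral measure lebesgue (E \<inter> cbox a b)) (cbox a b)" for a b
  proof -
    have "((\<lambda>x. 1::real) has_integral measure lebesgue (E \<inter> cbox a b)) (E \<inter> cbox a b)"
      using meas by (simp add: lmeasure_integral has_integral_iff lmeasurable_iff_integrable_on)
    then have "((\<lambda>x. if x \<in> E \<inter> cbox a b then 1 else 0::real)
        has_integral measure lebesgue (E \<inter> cbox a b)) UNIV"
      by (simp only: has_integral_restrict_UNIV)
    also have "(\<lambda>x. if x \<in> E \<inter> cbox a b then 1 else 0::real)
        = (\<lambda>x. if x \<in> cbox a b then f x else 0)"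
      by (auto simp: f_def indicator_def fun_eq_iff)
    finally show ?thesis by (simp only: has_integral_restrict_UNIV)
  qed
  obtain N where N: "negligible N"
    "\<And>x e. \<lbrakk>x \<notin> N; 0 < e\<rbrakk> \<Longrightarrow> \<exists>d>0. \<forall>h. 0 < h \<and> h < d \<longrightarrow>
        norm (integral (cbox x (x + h *\<^sub>R One)) f /\<^sub>R h ^ DIM(real ^ 'n) - f x) < e"
    using integrable_ccontinuous_explicit[of f] int by blast
  obtain x where x: "x \<in> E" "x \<notin> N"
    using pos N(1) negligible_subset by blast
  have "0 < 1 - c" using c by simp
  from N(2)[OF x(2) this] obtain d where d: "0 < d" "\<And>h. 0 < h \<Longrightarrow> h < d \<Longrightarrow>
      norm (integral (cbox x (x + h *\<^sub>R One)) f /\<^sub>R h ^ DIM(real ^ 'n) - f x) < 1 - c"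
    by blast
  show ?thesis
  proof
    show "0 < min 1 (d / 2)" "min 1 (d / 2) \<le> 1" using d by auto
    fix h assume h: "0 < h" "h \<le> min 1 (d / 2)"
    then have "norm (integral (cbox x (x + h *\<^sub>R One)) f /\<^sub>R h ^ DIM(real ^ 'n) - f x) < 1 - c"
      using d by (intro d(2)) auto
    moreover have "integral (cbox x (x + h *\<^sub>R One)) f = measure lebesgue (E \<inter> corner_cube x h)"
      using int by (simp add: corner_cube_eq integral_unique)
    ultimately have "\<bar>measure lebesgue (E \<inter> corner_cube x h) / h ^ CARD('n) - 1\<bar> < 1 - c"
      using x by (simp add: f_def divide_inverse_commute)
    then have "c < measure lebesgue (E \<inter> corner_cube x h) / h ^ CARD('n)" by linarith
    then show "c * h ^ CARD('n) \<le> measure lebesgue (E \<inter> corner_cube x h)"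
      using h by (simp add: field_simps)
  qed
qed

text \<open>
  With density at least \<open>3/4\<close> in every cube \<open>W j\<close> of side \<open>R / 2\<^sup>j\<close> at a common corner, and
  with \<open>W (Suc j)\<close> filling at most half of \<open>W j\<close>, at least a quarter of \<open>W j\<close> lies in \<open>E\<close> and
  outside \<open>W (Suc j)\<close>.
\<close>
lemma dyadic_annuli:
  fixes E :: "(real ^ 'n) set"
  assumes E: "E \<in> sets lebesgue" and pos: "\<not> negligible E"
  obtains a R S where "0 < R" "R \<le> 1" "disjoint_family S"
    "\<And>j. S j \<in> lmeasurable" "\<And>j. S j \<subseteq> E \<inter> corner_cube a (R / 2 ^ j)"
    "\<And>j. (R / 2 ^ j) ^ CARD('n) / 4 \<le> measure lebesgue (S j)"
proof -
  have "3 / 4 < (1 :: real)" by simp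
  from density_corner_cubes[OF E pos this] obtain a R where R: "0 < R" "R \<le> 1" and dens:
    "\<And>h. 0 < h \<Longrightarrow> h \<le> R \<Longrightarrow> 3 / 4 * h ^ CARD('n) \<le> measure lebesgue (E \<inter> corner_cube a h)"
    by metis
  define W where "W j = corner_cube a (R / 2 ^ j)" for j :: nat
  define S where "S j = E \<inter> W j - W (Suc j)" for j
  have W_anti: "W j \<subseteq> W i" if "i \<le> j" for i j
    using that R unfolding W_def
    by (intro corner_cube_mono divide_left_mono) (auto simp: power_increasing)
  have meas: "E \<inter> W j \<in> lmeasurable" "W j \<in> lmeasurable" for j
    using E by (auto simp: W_def corner_cube_lmeasurable fmeasurable_Int_fmeasurable Int_commute[of E])
  show ?thesis
  proof
    show "disjoint_family S"
      unfolding disjoint_family_on_def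
    proof (intro ballI impI)
      fix i j :: nat assume "i \<noteq> j"
      then have "Suc i \<le> j \<or> Suc j \<le> i" by auto
      then have "W j \<subseteq> W (Suc i) \<or> W i \<subseteq> W (Suc j)" using W_anti by blast
      then show "S i \<inter> S j = {}" unfolding S_def by blast
    qed
    fix j
    show "S j \<in> lmeasurable" unfolding S_def using meas by (intro fmeasurable.Diff)
    show "S j \<subseteq> E \<inter> corner_cube a (R / 2 ^ j)" by (auto simp: S_def W_def)
    have "2 * (R / 2 ^ Suc j) ^ CARD('n) \<le> 2 ^ CARD('n) * (R / 2 ^ Suc j) ^ CARD('n)"
      using R self_le_power[of "2::real" "CARD('n)"] by (intro mult_right_mono) auto
    also have "\<dots> = (R / 2 ^ j) ^ CARD('n)"
      by (simp flip: power_mult_distrib)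
    finally have half: "(R / 2 ^ Suc j) ^ CARD('n) \<le> (R / 2 ^ j) ^ CARD('n) / 2" by simp
    have "3 / 4 * (R / 2 ^ j) ^ CARD('n) \<le> measure lebesgue (E \<inter> W j)"
      unfolding W_def using R by (intro dens) (auto simp: divide_le_eq intro: order_trans[OF _ mult_left_mono[of 1]])
    also have "\<dots> \<le> measure lebesgue (S j \<union> W (Suc j))"
      by (rule measure_mono_fmeasurable)
        (use meas S_def \<open>S j \<in> lmeasurable\<close> in auto)
    also have "\<dots> \<le> measure lebesgue (S j) + measure lebesgue (W (Suc j))"
      using meas \<open>S j \<in> lmeasurable\<close> by (intro measure_Un_le) auto
    also have "measure lebesgue (W (Suc j)) = (R / 2 ^ Suc j) ^ CARD('n)"
      unfolding W_def using R by (intro measure_corner_cube) auto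
    finally show "(R / 2 ^ j) ^ CARD('n) / 4 \<le> measure lebesgue (S j)"
      using half by linarith
  qed (use R in auto)
qed

section \<open>Exponents close to one\<close>

text \<open>
  Since \<open>1 / p\<close> is at least \<open>1 - \<epsilon>\<close>, the value \<open>1 / q = 1 / p - \<theta>\<close> is at least half of \<open>1 - \<theta>\<close>.
  This keeps \<open>q\<close> finite, with a bound that does not depend on \<open>\<epsilon>\<close>.
\<close>
lemma exponent_relation:
  fixes p q :: ereal and \<theta> \<epsilon> :: real
  assumes p: "1 \<le> p" "p < ereal (1 + \<epsilon>)" and q: "1 \<le> q"
    and rel: "1 / p - 1 / q = ereal \<theta>" and \<theta>: "\<theta> < 1" and \<epsilon>: "\<epsilon> \<le> (1 - \<theta>) / 2"
  obtains P Q where "p = ereal P" "1 \<le> P" "P \<le> 1 + \<epsilon>" "q = ereal Q" "1 \<le> Q"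
    "Q \<le> 2 / (1 - \<theta>)" "1 / P - 1 / Q = \<theta>"
proof -
  obtain P where P: "p = ereal P" "1 \<le> P" "P < 1 + \<epsilon>" using p by (cases p) auto
  have "1 - \<epsilon> \<le> 1 / P"
  proof -
    have "(1 - \<epsilon>) * P \<le> 1"
    proof (cases "\<epsilon> \<le> 1")
      case True
      then have "(1 - \<epsilon>) * P \<le> (1 - \<epsilon>) * (1 + \<epsilon>)" using P by (intro mult_left_mono) auto
      also have "\<dots> \<le> 1" by (simp add: algebra_simps)
      finally show ?thesis .
    next
      case False
      then have "(1 - \<epsilon>) * P \<le> 0" using P by (intro mult_nonpos_nonneg) auto
      then show ?thesis by simp
    qed
    then show ?thesis using P by (simp add: field_simps)
  qed
  then have low: "(1 - \<theta>) / 2 \<le> 1 / P - \<theta>" using \<epsilon> by (simp add: field_simps)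
  show ?thesis
  proof (cases q)
    case (real Q)
    have rel': "1 / P - 1 / Q = \<theta>"
      using rel P real q by (simp add: one_ereal_def)
    have "1 \<le> Q" using real q by simp
    moreover from low rel' have "(1 - \<theta>) / 2 \<le> 1 / Q" by simp
    then have "Q \<le> 2 / (1 - \<theta>)" using \<theta> \<open>1 \<le> Q\<close> by (simp add: field_simps)
    ultimately show ?thesis using P real rel' by (intro that) auto
  next
    case PInf
    then have "1 / P = \<theta>" using rel P by (simp add: one_ereal_def)
    then show ?thesis using low \<theta> by simp
  qed (use q in auto)
qed

lemma p_minus_le_1_imp_nonnegligible:
  fixes p :: "real ^ 'n \<Rightarrow> ereal"
  assumes "p_minus p \<le> 1" and \<epsilon>: "0 < \<epsilon>" and AE: "AE x in lebesgue. T x"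
  shows "\<not> negligible {x. p x < ereal (1 + \<epsilon>) \<and> T x}"
proof
  assume "negligible {x. p x < ereal (1 + \<epsilon>) \<and> T x}"
  then have "AE x in lebesgue. x \<notin> {x. p x < ereal (1 + \<epsilon>) \<and> T x}"
    by (intro AE_not_in) (simp add: negligible_iff_null_sets)
  with AE have "AE x in lebesgue. ereal (1 + \<epsilon>) \<le> p x" by eventually_elim auto
  then have "ereal (1 + \<epsilon>) \<le> p_minus p"
    unfolding p_minus_def essinf_def by (intro Sup_upper) simp
  also have "\<dots> \<le> 1" by fact
  finally show False using \<epsilon> by (simp add: one_ereal_def)
qed

text \<open>
  The relation between the exponents gives \<open>Q = P + P \<theta> Q\<close>, hence
  \<open>(v\<^sup>\<theta> t)\<^sup>Q = t\<^sup>P (t\<^sup>P v)\<^bsup>\<theta> Q\<^esup>\<close>. So the power with exponent \<open>P\<close> is controlled by the one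
  with exponent \<open>Q\<close> as soon as \<open>t\<^sup>P v\<close> is bounded below; where it is not, \<open>t\<^sup>P\<close> itself is at most
  \<open>1 / (2 v)\<close>, which contributes no more than \<open>1/2\<close> to an integral over a set of measure \<open>v\<close>.
\<close>
lemma powr_le_exchange:
  fixes v t P Q \<theta> B D :: real
  assumes v: "0 < v" and t: "0 < t" and P: "1 \<le> P" and Q: "0 < Q" "Q \<le> B"
    and PQ: "1 / P - 1 / Q = \<theta>" and \<theta>: "0 \<le> \<theta>" and D: "1 \<le> D"
  shows "t powr P \<le> 1 / (2 * v) + (2 * D) powr B * (v powr \<theta> * t / D) powr Q"
proof (cases "t powr P * v \<le> 1 / 2")
  case True
  then have "t powr P \<le> 1 / (2 * v)" using v by (simp add: field_simps)
  moreover have "0 \<le> (2 * D) powr B * (v powr \<theta> * t / D) powr Q" by simp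
  ultimately show ?thesis by linarith
next
  case False
  have "1 / P \<le> 1" using P by simp
  moreover have "0 < 1 / Q" using Q by simp
  ultimately have "\<theta> \<le> 1" using PQ by linarith
  have Q_eq: "Q = P + P * (\<theta> * Q)"
    using P Q PQ[symmetric] by (simp add: field_simps)
  have "(v powr \<theta> * t) powr Q = v powr (\<theta> * Q) * t powr Q"
    using v t by (simp add: powr_mult powr_powr)
  also have "t powr Q = t powr P * (t powr P) powr (\<theta> * Q)"
    by (subst Q_eq) (simp add: powr_add powr_powr)
  finally have eq: "(v powr \<theta> * t) powr Q = t powr P * (t powr P * v) powr (\<theta> * Q)"
    using v t by (simp add: powr_mult mult_ac)
  have "(1 / 2) powr Q \<le> (1 / 2 :: real) powr (\<theta> * Q)"
    using \<open>\<theta> \<le> 1\<close> Q by (intro powr_mono') auto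
  also have "\<dots> \<le> (t powr P * v) powr (\<theta> * Q)"
    using False \<theta> Q by (intro powr_mono2) auto
  finally have "t powr P * (1 / 2) powr Q \<le> (v powr \<theta> * t) powr Q"
    unfolding eq by (intro mult_left_mono) auto
  then have "t powr P \<le> 2 powr Q * (v powr \<theta> * t) powr Q"
    by (simp add: powr_divide field_simps)
  also have "\<dots> = (2 * D) powr Q * (v powr \<theta> * t / D) powr Q"
    using D v t by (simp add: powr_divide powr_mult)
  also have "\<dots> \<le> (2 * D) powr B * (v powr \<theta> * t / D) powr Q"
    using D Q by (intro mult_right_mono powr_mono) auto
  finally show ?thesis using v by (smt (verit) divide_pos_pos)
qed

text \<open>
  A constant \<open>t\<close> on \<open>S\<close> whose modular with exponent \<open>P\<close> exceeds \<open>1\<close> has, after multiplication by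
  \<open>v\<^sup>\<theta> / D\<close>, a modular with exponent \<open>Q\<close> that is bounded below by a constant depending on \<open>B\<close> and \<open>D\<close>
  only. It does not matter how \<open>P\<close> varies on \<open>S\<close>.
\<close>
lemma nn_integral_powr_exchange:
  fixes v t \<theta> B D :: real and P Q :: "'a \<Rightarrow> real"
  assumes S: "S \<in> sets M" "emeasure M S \<le> ennreal v"
    and meas: "Q \<in> borel_measurable M"
    and v: "0 < v" and t: "0 < t" and D: "1 \<le> D" and \<theta>: "0 \<le> \<theta>"
    and PQ: "\<And>x. x \<in> S \<Longrightarrow> 1 \<le> P x \<and> 0 < Q x \<and> Q x \<le> B \<and> 1 / P x - 1 / Q x = \<theta>"
    and large: "1 < (\<integral>\<^sup>+x\<in>S. ennreal (t powr P x) \<partial>M)"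
  shows "ennreal (1 / (2 * (2 * D) powr B))
      \<le> (\<integral>\<^sup>+x\<in>S. ennreal ((v powr \<theta> * t / D) powr Q x) \<partial>M)" (is "_ \<le> ?I")
proof -
  define K where "K = (2 * D) powr B"
  have K: "0 < K" using D by (simp add: K_def)
  note [measurable] = meas S(1)
  have "1 < (\<integral>\<^sup>+x\<in>S. ennreal (t powr P x) \<partial>M)" by (rule large)
  also have "\<dots> \<le> (\<integral>\<^sup>+x. ennreal (1 / (2 * v)) * indicator S x
      + ennreal K * (ennreal ((v powr \<theta> * t / D) powr Q x) * indicator S x) \<partial>M)"
  proof (rule nn_integral_mono)
    fix x
    show "ennreal (t powr P x) * indicator S x \<le> ennreal (1 / (2 * v)) * indicator S x
      + ennreal K * (ennreal ((v powr \<theta> * t / D) powr Q x) * indicator S x)"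
    proof (cases "x \<in> S")
      case True
      then show ?thesis
        using powr_le_exchange[OF v t _ _ _ _ \<theta> D, of "P x" "Q x" B] PQ[OF True] v K
        by (simp add: K_def ennreal_mult[symmetric] ennreal_plus[symmetric] ennreal_leI
                 del: ennreal_plus)
    qed simp
  qed
  also have "\<dots> = ennreal (1 / (2 * v)) * emeasure M S + ennreal K * ?I"
    by (subst nn_integral_add) (auto simp: nn_integral_cmult nn_integral_cmult_indicator S)
  also have "\<dots> \<le> ennreal (1 / (2 * v)) * ennreal v + ennreal K * ?I"
    by (intro add_mono mult_left_mono S) auto
  also have "ennreal (1 / (2 * v)) * ennreal v = ennreal (1 / 2)"
    using v by (simp add: ennreal_mult[symmetric])
  finally have main: "1 < ennreal (1 / 2) + ennreal K * ?I" .
  show ?thesis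
  proof (cases "?I")
    case (real r)
    then have "1 < 1 / 2 + K * r"
      using main K unfolding real(2) ennreal_1[symmetric]
      by (subst (asm) ennreal_mult[symmetric], simp, simp add: real)
        (subst (asm) ennreal_plus[symmetric], simp, simp add: real,
          subst (asm) ennreal_less_iff, simp, assumption)
    then have "1 / (2 * K) \<le> r" using K by (simp add: field_simps)
    then show ?thesis using real by (simp add: K_def ennreal_leI)
  qed simp
qed

section \<open>Norms of normalised indicators across scales\<close>

text \<open>
  Here \<open>\<phi> l\<close> is the modular of \<open>u / l\<close> for \<open>u\<close> the indicator of \<open>S\<close> divided by \<open>v\<close>, so the
  conclusion determines the norm of \<open>u\<close> up to a factor of two, as a power of two. The norm is at
  least \<open>1/8\<close> because the modular at \<open>l = 1/8\<close> is at least \<open>8 / v \<cdot> v / 4 = 2\<close>, so \<open>k\<close> may be taken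
  in the natural numbers. It is at most about \<open>v\<^bsup>-\<epsilon>\<^esup>\<close> because the exponent is at most \<open>1 + \<epsilon>\<close>.
\<close>
lemma critical_scale:
  fixes v \<epsilon> :: real and P :: "'a \<Rightarrow> real" and M :: "'a measure" and S :: "'a set"
  defines "\<phi> \<equiv> \<lambda>l. \<integral>\<^sup>+x\<in>S. ennreal ((1 / (v * l)) powr P x) \<partial>M"
  assumes S: "S \<in> sets M" and v: "0 < v" "v \<le> 1"
    and S_le: "emeasure M S \<le> ennreal v" and S_ge: "ennreal (v / 4) \<le> emeasure M S"
    and \<epsilon>: "0 \<le> \<epsilon>" "\<epsilon> \<le> 1" and P: "\<And>x. x \<in> S \<Longrightarrow> 1 \<le> P x \<and> P x \<le> 1 + \<epsilon>"
  obtains k where "\<phi> (2 ^ k / 8) \<le> 1" "1 < \<phi> (2 ^ k / 16)"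
    "\<And>A. 8 * v powr (- \<epsilon>) \<le> 2 ^ A \<Longrightarrow> k \<le> A"
proof -
  define ok where "ok k \<longleftrightarrow> \<phi> (2 ^ k / 8) \<le> 1" for k :: nat
  have ok_large: "ok A" if A: "8 * v powr (- \<epsilon>) \<le> 2 ^ A" for A
  proof -
    define l :: real where "l = 2 ^ A / 8"
    have l: "v powr (- \<epsilon>) \<le> l" "0 < l" using A by (simp_all add: l_def)
    have bound: "(1 / (v * l)) powr P x \<le> 1 / v" if "x \<in> S" for x
    proof -
      have "v powr (1 - \<epsilon>) = v * v powr (- \<epsilon>)"
        using v by (simp add: powr_diff powr_minus divide_inverse)
      also have "\<dots> \<le> v * l" using v l by (intro mult_left_mono) auto
      finally have "(1 / (v * l)) powr P x \<le> (1 / v powr (1 - \<epsilon>)) powr P x"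
        using v l P[OF that] by (intro powr_mono2 divide_left_mono) auto
      also have "\<dots> = v powr (- ((1 - \<epsilon>) * P x))"
        using v by (simp add: powr_minus[symmetric] powr_powr divide_inverse algebra_simps)
      also have "\<dots> \<le> v powr (- 1)"
      proof (rule powr_mono')
        have "(1 - \<epsilon>) * P x \<le> (1 - \<epsilon>) * (1 + \<epsilon>)"
          using \<epsilon> P[OF that] by (intro mult_left_mono) auto
        also have "\<dots> \<le> 1" by (simp add: algebra_simps)
        finally show "- 1 \<le> - ((1 - \<epsilon>) * P x)" by simp
      qed (use v in auto)
      finally show ?thesis using v by (simp add: powr_minus divide_inverse)
    qed
    have "\<phi> l \<le> (\<integral>\<^sup>+x. ennreal (1 / v) * indicator S x \<partial>M)"
      unfolding \<phi>_def
      by (intro nn_integral_mono) (auto simp: indicator_def intro!: ennreal_leI bound)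
    also have "\<dots> = ennreal (1 / v) * emeasure M S"
      using S by (rule nn_integral_cmult_indicator)
    also have "\<dots> \<le> ennreal (1 / v) * ennreal v"
      by (intro mult_left_mono S_le) auto
    also have "\<dots> = 1" using v by (simp add: ennreal_mult[symmetric])
    finally show ?thesis by (simp add: ok_def l_def)
  qed
  have not_ok_0: "\<not> ok 0"
  proof -
    have "1 < ennreal (8 / v) * ennreal (v / 4)"
      using v by (simp add: ennreal_mult[symmetric])
    also have "\<dots> \<le> ennreal (8 / v) * emeasure M S"
      by (intro mult_left_mono S_ge) auto
    also have "\<dots> = (\<integral>\<^sup>+x. ennreal (8 / v) * indicator S x \<partial>M)"
      using S by (simp add: nn_integral_cmult_indicator)
    also have "\<dots> \<le> \<phi> (2 ^ 0 / 8)"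
      unfolding \<phi>_def
    proof (rule nn_integral_mono)
      fix x
      have "(8 / v) powr 1 \<le> (8 / v) powr P x" if "x \<in> S"
        using v P[OF that] by (intro powr_mono) auto
      then show "ennreal (8 / v) * indicator S x
          \<le> ennreal ((1 / (v * (2 ^ 0 / 8))) powr P x) * indicator S x"
        using v by (auto simp: indicator_def intro!: ennreal_leI)
    qed
    finally show ?thesis by (simp add: ok_def)
  qed
  obtain A :: nat where "8 * v powr (- \<epsilon>) < 2 ^ A"
    using real_arch_pow[of 2 "8 * v powr (- \<epsilon>)"] by auto
  then have "ok (LEAST k. ok k)" by (intro LeastI[of ok A] ok_large) simp
  moreover from this not_ok_0 obtain m where m: "(LEAST k. ok k) = Suc m"
    by (metis not0_implies_Suc)
  then have "\<not> ok m" by (intro not_less_Least) simp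
  ultimately show ?thesis
    using Least_le[of ok, OF ok_large]
    by (intro that[of "Suc m"]) (simp_all add: ok_def[symmetric] m not_le[symmetric], simp add: ok_def)
qed

text \<open>
  The cube of side \<open>R / 2\<^sup>j\<close> has volume \<open>v = R\<^sup>n / 2\<^bsup>n j\<^esup>\<close>, so \<open>v\<^bsup>-\<epsilon>\<^esup>\<close> grows like \<open>2\<^bsup>n \<epsilon> j\<^esup>\<close>; the
  hypothesis on \<open>\<epsilon>\<close> limits this to one factor of two every \<open>2 N\<close> steps.
\<close>
lemma slow_growth_of_scales:
  fixes R \<epsilon> :: real and N n :: nat
  assumes R: "0 < R" and \<epsilon>: "2 * real N * real n * \<epsilon> \<le> 1"
    and A: "8 * (R ^ n) powr (- \<epsilon>) \<le> 2 ^ A"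
  shows "8 * ((R / 2 ^ (2 * N * m)) ^ n) powr (- \<epsilon>) \<le> 2 ^ (A + m)"
proof -
  have "((R / 2 ^ (2 * N * m)) ^ n) powr (- \<epsilon>)
      = (R ^ n) powr (- \<epsilon>) * ((2 powr (2 * real N * real m * real n)) powr \<epsilon>)"
    using R by (simp add: power_divide powr_divide powr_minus_divide powr_realpow[symmetric]
        powr_powr powr_mult mult_ac)
  also have "\<dots> = (R ^ n) powr (- \<epsilon>) * 2 powr (2 * real N * real n * \<epsilon> * real m)"
    by (simp add: powr_powr mult_ac)
  also have "\<dots> \<le> (R ^ n) powr (- \<epsilon>) * 2 powr (1 * real m)"
    using \<epsilon> by (intro mult_left_mono powr_mono mult_right_mono) auto
  finally have "8 * ((R / 2 ^ (2 * N * m)) ^ n) powr (- \<epsilon>)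
      \<le> 8 * (R ^ n) powr (- \<epsilon>) * 2 ^ m" by (simp add: powr_realpow)
  also have "\<dots> \<le> 2 ^ A * 2 ^ m" using A by (intro mult_right_mono) auto
  finally show ?thesis by (simp add: power_add)
qed

text \<open>
  If every \<open>J \<ge> N\<close> had a strictly smaller value among the \<open>N\<close> indices before it, the values
  would increase by at least one per \<open>N\<close> steps, so that \<open>k J \<ge> J div N\<close>. That is twice the
  assumed growth rate.
\<close>
lemma slow_growth_pigeonhole:
  fixes k :: "nat \<Rightarrow> nat"
  assumes N: "0 < N" and slow: "\<And>m. k (2 * N * m) \<le> A + m"
  shows "\<exists>J\<ge>N. \<forall>i\<in>{J - N..<J}. k J \<le> k i"
proof (rule ccontr)
  assume "\<not> ?thesis"
  then have step: "\<exists>i\<in>{J - N..<J}. k i < k J" if "N \<le> J" for J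
    using that by (meson linorder_not_le)
  have "J div N \<le> k J" for J
  proof (induction J rule: less_induct)
    case (less J)
    show ?case
    proof (cases "N \<le> J")
      case True
      from step[OF this] obtain i where i: "J - N \<le> i" "i < J" "k i < k J"
        by (auto simp: Bex_def)
      have "J div N = Suc ((J - N) div N)" using True N by (simp add: le_div_geq)
      also have "\<dots> \<le> Suc (i div N)" using i by (simp add: div_le_mono)
      also have "\<dots> \<le> Suc (k i)" using less i by simp
      finally show ?thesis using i by simp
    qed simp
  qed
  from this[of "2 * N * (A + 1)"] slow[of "A + 1"] N show False
    by (simp add: algebra_simps)
qed

section \<open>Norms and maximal functions of multiples of indicators\<close>

lemma Lnorm_le: "0 < l \<Longrightarrow> modular p (\<lambda>x. f x / ereal l) \<le> 1 \<Longrightarrow> Lnorm p f \<le> ennreal l"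
  unfolding Lnorm_def by (intro Inf_lower) auto

lemma modular_scaled_indicator:
  fixes p :: "real ^ 'n \<Rightarrow> ereal"
  assumes c: "0 \<le> c" and S: "S \<inter> Omega_inf p = {}"
  shows "modular p (\<lambda>x. if x \<in> S then ereal c else 0)
      = (\<integral>\<^sup>+x\<in>S. ennreal (c powr real_of_ereal (p x)) \<partial>lebesgue)"
proof -
  let ?f = "\<lambda>x. if x \<in> S then ereal c else 0"
  let ?R = "restrict_space lebesgue (Omega_inf p)"
  have zero: "modulus ?f x = 0" if "x \<in> space ?R" for x
    using that S by (auto simp: modulus_def space_restrict_space e2ennreal_neg)
  have "modulus ?f \<in> borel_measurable ?R"
    using zero by (subst measurable_cong[where g = "\<lambda>_. 0"]) auto
  then have "esssup ?R (modulus ?f) = Inf {z. AE x in ?R. modulus ?f x \<le> z}"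
    by (rule esssup_eq_AE)
  \<comment> \<open>If \<open>Omega_inf p\<close> is a null set, this infimum is the infimum of all of \<open>ennreal\<close>, again \<open>0\<close>.\<close>
  also have "\<dots> \<le> 0" using zero by (intro Inf_lower) (auto intro!: AE_I2)
  finally have "esssup ?R (modulus ?f) = 0" by simp
  moreover have "(\<integral>\<^sup>+x\<in>- Omega_inf p. ennreal_powr (modulus ?f x) (real_of_ereal (p x)) \<partial>lebesgue)
      = (\<integral>\<^sup>+x\<in>S. ennreal (c powr real_of_ereal (p x)) \<partial>lebesgue)"
    using S c
    by (intro nn_integral_cong)
      (auto simp: indicator_def ennreal_powr_def modulus_def e2ennreal_neg)
  ultimately show ?thesis by (simp add: modular_def)
qed

text \<open>
  The function \<open>f\<close> will be a maximal function. Its modular is bounded below through the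
  measurable function that equals \<open>c i powr q\<close> on each \<open>S i\<close>, by monotonicity of the integral.
\<close>
lemma modular_ge_sum:
  fixes q :: "real ^ 'n \<Rightarrow> ereal"
  assumes q: "q \<in> borel_measurable lebesgue" and I: "finite I" "disjoint_family_on S I"
    and S: "\<And>i. i \<in> I \<Longrightarrow> S i \<in> sets lebesgue"
    and c: "\<And>i. i \<in> I \<Longrightarrow> 0 \<le> c i"
    and q_S: "\<And>i x. i \<in> I \<Longrightarrow> x \<in> S i \<Longrightarrow> q x \<noteq> \<infinity> \<and> 0 \<le> q x"
    and f: "\<And>i x. i \<in> I \<Longrightarrow> x \<in> S i \<Longrightarrow> ennreal (c i) \<le> modulus f x"
  shows "(\<Sum>i\<in>I. \<integral>\<^sup>+x\<in>S i. ennreal (c i powr real_of_ereal (q x)) \<partial>lebesgue) \<le> modular q f"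
proof -
  note [measurable] = q
  have "(\<Sum>i\<in>I. \<integral>\<^sup>+x\<in>S i. ennreal (c i powr real_of_ereal (q x)) \<partial>lebesgue)
      = (\<integral>\<^sup>+x. (\<Sum>i\<in>I. ennreal (c i powr real_of_ereal (q x)) * indicator (S i) x) \<partial>lebesgue)"
  proof (rule nn_integral_sum[symmetric])
    fix i assume "i \<in> I"
    note [measurable] = S[OF this]
    show "(\<lambda>x. ennreal (c i powr real_of_ereal (q x)) * indicator (S i) x)
        \<in> borel_measurable lebesgue" by measurable
  qed
  also have "\<dots> \<le> (\<integral>\<^sup>+x\<in>- Omega_inf q. ennreal_powr (modulus f x) (real_of_ereal (q x)) \<partial>lebesgue)"
  proof (rule nn_integral_mono)
    fix x
    show "(\<Sum>i\<in>I. ennreal (c i powr real_of_ereal (q x)) * indicator (S i) x)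
      \<le> ennreal_powr (modulus f x) (real_of_ereal (q x)) * indicator (- Omega_inf q) x"
    proof (cases "\<exists>i\<in>I. x \<in> S i")
      case True
      then obtain i where i: "i \<in> I" "x \<in> S i" by blast
      have "x \<notin> S j" if "j \<in> I" "j \<noteq> i" for j
        using I(2) i that by (auto simp: disjoint_family_on_def)
      then have "(\<Sum>i\<in>I. ennreal (c i powr real_of_ereal (q x)) * indicator (S i) x)
          = (\<Sum>j\<in>I. if j = i then ennreal (c i powr real_of_ereal (q x)) else 0)"
        using i by (intro sum.cong) auto
      also have "\<dots> = ennreal (c i powr real_of_ereal (q x))" using I(1) i by simp
      also have "\<dots> \<le> ennreal_powr (modulus f x) (real_of_ereal (q x))"
      proof (cases "modulus f x")
        case (real r)
        then show ?thesis
          using f[OF i] c[OF i(1)] q_S[OF i]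
          by (auto simp: ennreal_powr_def real_of_ereal_pos intro!: ennreal_leI powr_mono2)
      qed (simp add: ennreal_powr_def)
      finally show ?thesis using q_S[OF i] by (simp add: Omega_inf_def)
    next
      case False
      then have "(\<Sum>i\<in>I. ennreal (c i powr real_of_ereal (q x)) * indicator (S i) x) = 0"
        by (intro sum.neutral) auto
      then show ?thesis by simp
    qed
  qed
  also have "\<dots> \<le> modular q f" by (simp add: modular_def)
  finally show ?thesis .
qed

lemma frac_maximal_scaled_indicator:
  fixes a x :: "real ^ 'n"
  assumes S: "S \<in> lmeasurable" "S \<subseteq> corner_cube a h" and x: "x \<in> corner_cube a h"
    and h: "0 < h" and c: "0 \<le> c"
  shows "ereal ((h ^ CARD('n)) powr (\<alpha> / real CARD('n)) * (c * measure lebesgue S / h ^ CARD('n)))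
    \<le> frac_maximal \<alpha> (\<lambda>y. if y \<in> S then ereal c else 0) x"
proof -
  let ?f = "\<lambda>y. if y \<in> S then ereal c else 0"
  let ?Q = "corner_cube a h"
  have "(\<integral>\<^sup>+y\<in>?Q. modulus ?f y \<partial>lebesgue) = (\<integral>\<^sup>+y. ennreal c * indicator S y \<partial>lebesgue)"
    using S(2) c by (intro nn_integral_cong) (auto simp: indicator_def modulus_def e2ennreal_neg)
  also have "\<dots> = ennreal c * emeasure lebesgue S"
    using S by (intro nn_integral_cmult_indicator) auto
  also have "\<dots> = ennreal (c * measure lebesgue S)"
    using S c by (simp add: emeasure_eq_measure2 ennreal_mult)
  finally have int: "(\<integral>\<^sup>+y\<in>?Q. modulus ?f y \<partial>lebesgue) = ennreal (c * measure lebesgue S)" .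
  have "ennreal ((h ^ CARD('n)) powr (\<alpha> / real CARD('n)) * (c * measure lebesgue S / h ^ CARD('n)))
    = ennreal (measure lebesgue ?Q powr (\<alpha> / real CARD('n)))
      * (ennreal (1 / measure lebesgue ?Q) * (\<integral>\<^sup>+y\<in>?Q. modulus ?f y \<partial>lebesgue))"
    unfolding int using h c by (simp add: measure_corner_cube ennreal_mult[symmetric])
  also have "\<dots> \<le> (SUP Q\<in>{Q \<in> cubes. x \<in> Q}. ennreal (measure lebesgue Q powr (\<alpha> / real CARD('n)))
      * (ennreal (1 / measure lebesgue Q) * (\<integral>\<^sup>+y\<in>Q. modulus ?f y \<partial>lebesgue)))"
    using x h by (intro SUP_upper) (simp add: corner_cube_in_cubes)
  finally show ?thesis
    unfolding frac_maximal_def using h c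
    by (subst (asm) less_eq_ennreal.rep_eq) (simp add: enn2ereal_ennreal)
qed

section \<open>Bounded fractional maximal operators force the exponent away from one\<close>

theorem theorem1p1:
  fixes \<alpha> :: real and p q :: "real ^ 'n \<Rightarrow> ereal"
  assumes "0 \<le> \<alpha>" and "\<alpha> < real CARD('n)"
    and "p \<in> exponents"
    and "p_plus p \<le> ereal (real CARD('n)) / ereal \<alpha>"
    and "q \<in> exponents"
    and "AE x in lebesgue. 1 / p x - 1 / q x = ereal (\<alpha> / real CARD('n))"
    and "maps_into (frac_maximal \<alpha>) p q"
  shows "1 < p_minus p"
proof (rule ccontr)
  assume "\<not> 1 < p_minus p"
  then have p_minus: "p_minus p \<le> 1" by simp
  let ?n = "CARD('n)"
  define \<theta> where "\<theta> = \<alpha> / real ?n"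
  define B where "B = 2 / (1 - \<theta>)"
  have \<theta>: "0 \<le> \<theta>" "\<theta> < 1" using assms(1,2) by (auto simp: \<theta>_def)
  obtain C :: real where C: "0 \<le> C"
    "\<And>f. f \<in> Lspace p \<Longrightarrow> Lnorm q (frac_maximal \<alpha> f) \<le> ennreal C * Lnorm p f"
    using assms(7) by (auto simp: maps_into_def)
  \<comment> \<open>The factor \<open>8\<close> combines the density \<open>1/4\<close> of the annuli with the factor \<open>2\<close> in the critical
    scale; \<open>C + 1\<close> in place of \<open>C\<close> leaves room for an infimum that need not be attained.\<close>
  define D where "D = 8 * (C + 1)"
  have D: "1 \<le> D" using C by (simp add: D_def)
  define K where "K = 2 * (2 * D) powr B"
  have K: "0 < K" using D by (simp add: K_def)
  \<comment> \<open>Each annulus will contribute at least \<open>1 / K\<close> to a modular that is at most \<open>1\<close>, so \<open>N > K\<close>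
    annuli are too many. \<open>N\<close> is fixed before \<open>\<epsilon>\<close>, which has to be small relative to \<open>1 / N\<close>.\<close>
  obtain N :: nat where N: "K < real N" using reals_Archimedean2 by blast
  then have N0: "0 < N" using K by (metis of_nat_0_less_iff order.strict_trans)
  define \<epsilon> where "\<epsilon> = min ((1 - \<theta>) / 2) (1 / (2 * real N * real ?n))"
  have \<epsilon>: "0 < \<epsilon>" "\<epsilon> \<le> (1 - \<theta>) / 2"
    using \<theta> N0 unfolding \<epsilon>_def by (simp, intro min.cobounded1)
  then have \<epsilon>_le: "\<epsilon> \<le> 1" using \<theta> by simp
  have "2 * real N * real ?n * \<epsilon> \<le> 2 * real N * real ?n * (1 / (2 * real N * real ?n))"
    unfolding \<epsilon>_def by (intro mult_left_mono) auto
  also have "\<dots> = 1" using N0 by simp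
  finally have N_\<epsilon>: "2 * real N * real ?n * \<epsilon> \<le> 1" .

  have p: "p \<in> borel_measurable lebesgue" "\<And>x. 1 \<le> p x"
    and q: "q \<in> borel_measurable lebesgue" "\<And>x. 1 \<le> q x"
    using assms(3,5) by (auto simp: exponents_def)
  note [measurable] = p(1) q(1) borel_measurable_ereal_divide
  define E where "E = {x. p x < ereal (1 + \<epsilon>) \<and> 1 / p x - 1 / q x = ereal \<theta>}"
  have "E = {x \<in> space lebesgue. p x < ereal (1 + \<epsilon>) \<and> 1 / p x - 1 / q x = ereal \<theta>}"
    by (simp add: E_def)
  also have "\<dots> \<in> sets lebesgue" by measurable
  finally have E: "E \<in> sets lebesgue" .
  have E_pos: "\<not> negligible E"
    unfolding E_def
    by (intro p_minus_le_1_imp_nonnegligible[OF p_minus \<epsilon>(1)]) (use assms(6) in \<open>simp add: \<theta>_def\<close>)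
  define P where "P x = real_of_ereal (p x)" for x
  define Q where "Q x = real_of_ereal (q x)" for x
  have on_E: "p x = ereal (P x) \<and> q x = ereal (Q x) \<and> 1 \<le> P x \<and> P x \<le> 1 + \<epsilon>
      \<and> 1 \<le> Q x \<and> Q x \<le> B \<and> 1 / P x - 1 / Q x = \<theta>" if "x \<in> E" for x
  proof -
    from that have "p x < ereal (1 + \<epsilon>)" "1 / p x - 1 / q x = ereal \<theta>" by (auto simp: E_def)
    from exponent_relation[OF p(2) this(1) q(2) this(2) \<theta>(2) \<epsilon>(2)] show ?thesis
      by (metis B_def P_def Q_def real_of_ereal.simps(1))
  qed

  obtain a R S where R: "0 < R" "R \<le> 1" and S_disj: "disjoint_family S"
    and S: "\<And>j. S j \<in> lmeasurable" "\<And>j. S j \<subseteq> E \<inter> corner_cube a (R / 2 ^ j)"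
      "\<And>j. (R / 2 ^ j) ^ ?n / 4 \<le> measure lebesgue (S j)"
    using dyadic_annuli[OF E E_pos] by metis
  define h where "h j = R / 2 ^ j" for j :: nat
  define v where "v j = h j ^ ?n" for j
  have h: "0 < h j" "h j \<le> 1" for j
  proof -
    show "0 < h j" using R by (simp add: h_def)
    have "R / 2 ^ j \<le> 1 / 1" using R by (intro frac_le) auto
    then show "h j \<le> 1" by (simp add: h_def)
  qed
  have v: "0 < v j" "v j \<le> 1" for j
    using h[of j] by (auto simp: v_def power_le_one)
  have S_E: "x \<in> E" "x \<in> corner_cube a (h j)" if "x \<in> S j" for x j
    using S(2) that by (auto simp: h_def)
  have S_ge: "v j / 4 \<le> measure lebesgue (S j)" for j using S(3) by (simp add: v_def h_def)
  have "measure lebesgue (S j) \<le> measure lebesgue (corner_cube a (h j))" for j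
    using S S_E by (intro measure_mono_fmeasurable) (auto simp: corner_cube_lmeasurable)
  then have S_le: "measure lebesgue (S j) \<le> v j" for j
    unfolding v_def by (metis h(1) less_imp_le measure_corner_cube)
  have em: "emeasure lebesgue (S j) = ennreal (measure lebesgue (S j))" for j
    using S(1) by (simp add: emeasure_eq_measure2)
  have S_sets: "S j \<in> sets lebesgue" for j using S(1) by auto

  define \<phi> where "\<phi> j l = (\<integral>\<^sup>+x\<in>S j. ennreal ((1 / (v j * l)) powr P x) \<partial>lebesgue)" for j l
  have "\<exists>k. \<phi> j (2 ^ k / 8) \<le> 1 \<and> 1 < \<phi> j (2 ^ k / 16)
      \<and> (\<forall>A. 8 * v j powr (- \<epsilon>) \<le> 2 ^ A \<longrightarrow> k \<le> A)" for j
  proof (rule critical_scale[OF S_sets[of j] v[of j], of \<epsilon> P])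
    show "emeasure lebesgue (S j) \<le> ennreal (v j)" "ennreal (v j / 4) \<le> emeasure lebesgue (S j)"
      unfolding em using S_le S_ge by (auto intro: ennreal_leI)
  qed (use \<epsilon>(1) \<epsilon>_le on_E S_E in \<open>auto simp: \<phi>_def\<close>)
  then obtain k where k: "\<And>j. \<phi> j (2 ^ k j / 8) \<le> 1" "\<And>j. 1 < \<phi> j (2 ^ k j / 16)"
    "\<And>j A. 8 * v j powr (- \<epsilon>) \<le> 2 ^ A \<Longrightarrow> k j \<le> A" by metis
  \<comment> \<open>\<open>b j\<close> is the norm of the normalised indicator of \<open>S j\<close>, up to a factor of two.\<close>
  define b :: "nat \<Rightarrow> real" where "b j = 2 ^ k j / 8" for j
  have b: "0 < b j" for j by (simp add: b_def)

  \<comment> \<open>Choose \<open>J\<close> such that the norm at scale \<open>J\<close> is no larger than at the \<open>N\<close> scales before it.\<close>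
  obtain A :: nat where A: "8 * (R ^ ?n) powr (- \<epsilon>) < 2 ^ A"
    using real_arch_pow[of 2 "8 * (R ^ ?n) powr (- \<epsilon>)"] by auto
  have "k (2 * N * m) \<le> A + m" for m
    using slow_growth_of_scales[OF R(1) N_\<epsilon> less_imp_le[OF A]]
    by (intro k(3)) (simp add: v_def h_def)
  then obtain J where J: "N \<le> J" "\<And>i. i \<in> {J - N..<J} \<Longrightarrow> k J \<le> k i"
    using slow_growth_pigeonhole[OF N0] by metis
  define I where "I = {J - N..<J}"
  have b_le: "b J \<le> b i" if "i \<in> I" for i
    using J(2)[of i] that by (simp add: b_def I_def power_increasing)

  define f :: "real ^ 'n \<Rightarrow> ereal" where "f = (\<lambda>x. if x \<in> S J then ereal (1 / v J) else 0)"
  have "f \<in> borel_measurable lebesgue" unfolding f_def using S_sets by measurable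
  have "(\<lambda>x. f x / ereal (b J)) = (\<lambda>x. if x \<in> S J then ereal (1 / (v J * b J)) else 0)"
    using b[of J] by (auto simp: f_def fun_eq_iff)
  moreover have "S J \<inter> Omega_inf p = {}"
    using S_E on_E by (fastforce simp: Omega_inf_def)
  ultimately have "modular p (\<lambda>x. f x / ereal (b J)) = \<phi> J (b J)"
    using v[of J] b[of J] by (simp add: modular_scaled_indicator \<phi>_def P_def less_imp_le)
  then have mod_f: "modular p (\<lambda>x. f x / ereal (b J)) \<le> 1" using k(1)[of J] by (simp add: b_def)
  then have "modular p (\<lambda>x. f x / ereal (b J)) < \<infinity>"
    by (rule order.strict_trans1) simp
  then have "f \<in> Lspace p"
    using \<open>f \<in> borel_measurable lebesgue\<close> b[of J] by (auto simp: Lspace_def)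
  then have "Lnorm q (frac_maximal \<alpha> f) \<le> ennreal C * Lnorm p f" by (rule C(2))
  also have "\<dots> \<le> ennreal C * ennreal (b J)"
    using b mod_f by (intro mult_left_mono Lnorm_le) auto
  also have "\<dots> < ennreal ((C + 1) * b J)"
    using C b[of J] by (simp add: ennreal_mult[symmetric] ennreal_less_iff algebra_simps)
  finally obtain l where l: "0 < l" "ennreal l < ennreal ((C + 1) * b J)"
    "modular q (\<lambda>x. frac_maximal \<alpha> f x / ereal l) \<le> 1"
    unfolding Lnorm_def Inf_less_iff by auto
  then have l_less: "l < (C + 1) * b J" by (simp add: ennreal_less_iff)

  \<comment> \<open>\<open>t i\<close> is the value on \<open>S i\<close> of the normalised indicator divided by half of \<open>b i\<close>, where the
    modular with exponent \<open>p\<close> is still greater than \<open>1\<close>.\<close>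
  define t where "t i = 2 / (v i * b i)" for i
  have t: "0 < t i" for i using v b by (simp add: t_def)
  have Mf: "ennreal (v i powr \<theta> * t i / D) \<le> modulus (\<lambda>x. frac_maximal \<alpha> f x / ereal l) x"
    if i: "i \<in> I" and x: "x \<in> S i" for i x
  proof -
    have "h J \<le> h i"
      using i R unfolding h_def I_def by (intro divide_left_mono power_increasing) auto
    then have "S J \<subseteq> corner_cube a (h i)" using S_E(2) corner_cube_mono by blast
    then have "ereal (v i powr \<theta> * (1 / v J * measure lebesgue (S J) / v i)) \<le> frac_maximal \<alpha> f x"
      unfolding v_def \<theta>_def f_def
      using S_E(2)[OF x] h(1)[of J]
      by (intro frac_maximal_scaled_indicator S h) (auto intro: less_imp_le)
    moreover have "v i powr \<theta> * (1 / 4 / v i) \<le> v i powr \<theta> * (1 / v J * measure lebesgue (S J) / v i)"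
      using S_ge[of J] v by (intro mult_left_mono divide_right_mono) (auto simp: field_simps less_imp_le)
    ultimately have Mf_ge: "ereal (v i powr \<theta> * (1 / 4 / v i)) \<le> frac_maximal \<alpha> f x"
      by (meson ereal_less_eq(3) order_trans)
    have "(C + 1) * b J \<le> (C + 1) * b i"
      using C(1) by (intro mult_left_mono b_le i) simp
    with l_less have l_le: "l \<le> (C + 1) * b i" by linarith
    have "2 / (x * y) / (8 * z) = 1 / 4 / x / (z * y)" for x y z :: real by simp
    then have "t i / D = 1 / 4 / v i / ((C + 1) * b i)" unfolding t_def D_def .
    also have "\<dots> \<le> 1 / 4 / v i / l"
      using l_le l(1) v(1)[of i] by (intro divide_left_mono) auto
    finally have "t i / D \<le> 1 / 4 / v i / l" .
    then have "v i powr \<theta> * (t i / D) \<le> v i powr \<theta> * (1 / 4 / v i / l)"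
      by (intro mult_left_mono) auto
    then have "ereal (v i powr \<theta> * t i / D) \<le> ereal (v i powr \<theta> * (1 / 4 / v i)) / ereal l"
      using l by simp
    also have "\<dots> \<le> frac_maximal \<alpha> f x / ereal l"
      using Mf_ge l by (intro ereal_divide_right_mono) auto
    also have "\<dots> \<le> \<bar>frac_maximal \<alpha> f x / ereal l\<bar>" by (cases "frac_maximal \<alpha> f x / ereal l") auto
    finally show ?thesis
      unfolding modulus_def by (metis e2ennreal_ereal e2ennreal_mono)
  qed

  have "1 < ennreal (real N) * ennreal (1 / K)"
    using N K by (simp add: ennreal_mult[symmetric])
  also have "\<dots> = (\<Sum>i\<in>I. ennreal (1 / K))"
    using J(1) by (simp add: I_def ennreal_of_nat_eq_real_of_nat)
  also have "\<dots> \<le> (\<Sum>i\<in>I. \<integral>\<^sup>+x\<in>S i. ennreal ((v i powr \<theta> * t i / D) powr Q x) \<partial>lebesgue)"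
  proof (rule sum_mono)
    fix i assume "i \<in> I"
    show "ennreal (1 / K) \<le> (\<integral>\<^sup>+x\<in>S i. ennreal ((v i powr \<theta> * t i / D) powr Q x) \<partial>lebesgue)"
      unfolding K_def
    proof (rule nn_integral_powr_exchange[OF S_sets _ _ v(1) t D \<theta>(1)])
      show "emeasure lebesgue (S i) \<le> ennreal (v i)"
        unfolding em using S_le by (auto intro: ennreal_leI)
      show "Q \<in> borel_measurable lebesgue" unfolding Q_def by measurable
      show "1 < (\<integral>\<^sup>+x\<in>S i. ennreal (t i powr P x) \<partial>lebesgue)"
        using k(2)[of i] by (simp add: \<phi>_def t_def b_def)
    qed (use on_E S_E in force)
  qed
  also have "\<dots> \<le> modular q (\<lambda>x. frac_maximal \<alpha> f x / ereal l)"
    unfolding Q_def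
  proof (rule modular_ge_sum[OF q(1)])
    show "disjoint_family_on S I" using S_disj by (auto simp: disjoint_family_on_def)
    show "q x \<noteq> \<infinity> \<and> 0 \<le> q x" if "x \<in> S i" for i x
      using on_E[OF S_E(1)[OF that]] order_trans[OF _ q(2), of 0 x] by auto
    show "0 \<le> v i powr \<theta> * t i / D" for i using t[of i] D by simp
  qed (use S_sets Mf in \<open>simp_all add: I_def\<close>)
  also have "\<dots> \<le> 1" by (rule l(3))
  finally show False by simp
qed

end
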